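(* For arbitrary integers $p, q, r$ with $0 < p \le q \le r \le 2q$, there exists a finite simple connected graph $G$ with $\operatorname{ind-match}(G) = p$, $\operatorname{min-match}(G) = q$, and $\operatorname{match}(G) = r$.
   Context: A matching of $G$ is a set of pairwise disjoint edges; a maximal matching is one not properly contained in another matching. $\operatorname{match}(G)$ is the maximum cardinality of a matching and $\operatorname{min-match}(G)$ the minimum cardinality of a maximal matching. Two edges $e, e'$ are $3$-disjoint if $e \cap e' = \emptyset$ and no edge $f$ meets both; an induced matching is a set of pairwise $3$-disjoint edges, and $\operatorname{ind-match}(G)$ is the maximum cardinality of an induced matching. *)

theory Defs
  imports "Graph_Theory.Digraph_Component"
begin

text \<open>
  A finite simple graph is a \<^locale>\<open>graph\<close> in the sense of Graph_Theory, i.e. a finite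
  loop-free symmetric digraph without parallel arcs. An edge is then a pair of opposite
  arcs; it is represented below by the set of its two endpoints.
\<close>

definition edges :: "('a, 'b) pre_digraph \<Rightarrow> 'a set set" where
  "edges G = {{u, v} |u v. u \<rightarrow>\<^bsub>G\<^esub> v}"

definition matching :: "('a, 'b) pre_digraph \<Rightarrow> 'a set set \<Rightarrow> bool" where
  "matching G M \<longleftrightarrow> M \<subseteq> edges G \<and> pairwise disjnt M"

definition maximal_matching :: "('a, 'b) pre_digraph \<Rightarrow> 'a set set \<Rightarrow> bool" where
  "maximal_matching G M \<longleftrightarrow> matching G M \<and> (\<nexists>M'. matching G M' \<and> M \<subset> M')"

definition three_disjoint :: "('a, 'b) pre_digraph \<Rightarrow> 'a set \<Rightarrow> 'a set \<Rightarrow> bool" where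
  "three_disjoint G e e' \<longleftrightarrow>
     e \<inter> e' = {} \<and> (\<nexists>f. f \<in> edges G \<and> f \<inter> e \<noteq> {} \<and> f \<inter> e' \<noteq> {})"

definition induced_matching :: "('a, 'b) pre_digraph \<Rightarrow> 'a set set \<Rightarrow> bool" where
  "induced_matching G M \<longleftrightarrow> M \<subseteq> edges G \<and> pairwise (three_disjoint G) M"

text \<open>
  The extrema are taken over sets of naturals that are finite and nonempty for every
  finite graph, the only case in which the three invariants are meaningful.
\<close>

definition match_num :: "('a, 'b) pre_digraph \<Rightarrow> nat" where
  "match_num G = Max {card M |M. matching G M}"

definition min_match_num :: "('a, 'b) pre_digraph \<Rightarrow> nat" where
  "min_match_num G = Min {card M |M. maximal_matching G M}"

definition ind_match_num :: "('a, 'b) pre_digraph \<Rightarrow> nat" where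
  "ind_match_num G = Max {card M |M. induced_matching G M}"

end

theory Submission
  imports Defs
begin

text \<open>
  Take $2q$ core vertices, grouped into $q$ consecutive pairs, and split the pairs into $p$
  nonempty parts; make every part a clique. Hang a leaf on each of the first $2(r-q)$ core vertices
  and join one further vertex $2r$ to all core vertices.
  Every edge meets exactly one part, and two edges meeting the same part are never 3-disjoint,
  so an induced matching has at most $p$ edges. A maximal matching misses at most one
  vertex of each part; as the parts have even size, it needs at least half as many edges at
  a part as the part has vertices, hence $q$ edges in total. Finally there are $2r + 1$ vertices,
  which bounds every matching by $r$.
  The bounds are attained by one pair from each part, by all pairs, and by all leaf edges together
  with the pairs carrying no leaf.
\<close>

section \<open>Evaluating the extrema, and matchings in arbitrary graphs\<close>

lemma match_num_eqI:
  assumes "\<And>M. matching G M \<Longrightarrow> card M \<le> n" and "matching G M" and "card M = n"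
  shows "match_num G = n"
  unfolding match_num_def
proof (rule Max_eqI)
  \<comment> \<open>The upper bound itself supplies the finiteness without which \<open>Max\<close>
    is unspecified.\<close>
  show "finite {card M |M. matching G M}"
    by (rule finite_subset[of _ "{..n}"]) (use assms(1) in auto)
qed (use assms in auto)

lemma ind_match_num_eqI:
  assumes "\<And>M. induced_matching G M \<Longrightarrow> card M \<le> n" and "induced_matching G M" and "card M = n"
  shows "ind_match_num G = n"
  unfolding ind_match_num_def
proof (rule Max_eqI)
  show "finite {card M |M. induced_matching G M}"
    by (rule finite_subset[of _ "{..n}"]) (use assms(1) in auto)
qed (use assms in auto)

text \<open>A lower bound does not confine the set of cardinalities, so here finiteness comes from
  \<open>edges G\<close>.\<close>

lemma min_match_num_eqI:
  assumes "finite (edges G)" and "\<And>M. maximal_matching G M \<Longrightarrow> n \<le> card M"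
    and "maximal_matching G M" and "card M = n"
  shows "min_match_num G = n"
  unfolding min_match_num_def
proof (rule Min_eqI)
  have "{card M |M. maximal_matching G M} \<subseteq> card ` Pow (edges G)"
    by (auto simp: maximal_matching_def matching_def)
  then show "finite {card M |M. maximal_matching G M}"
    by (rule finite_subset) (simp add: assms(1))
qed (use assms in auto)

text \<open>An edge missing all of \<open>\<Union>M\<close> could be added to \<open>M\<close>;
  being nonempty, it is not already there.\<close>

lemma maximal_matching_covers:
  assumes "maximal_matching G M" and "e \<in> edges G" and "e \<noteq> {}"
  shows "e \<inter> \<Union>M \<noteq> {}"
proof
  assume disj: "e \<inter> \<Union>M = {}"
  then have "disjnt e f" "disjnt f e" if "f \<in> M" for f
    using that by (auto simp: disjnt_def)
  then have "matching G (insert e M)"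
    using assms(1,2) by (auto simp: maximal_matching_def matching_def pairwise_insert)
  moreover have "e \<notin> M"
    using disj assms(3) by blast
  ultimately show False
    using assms(1) unfolding maximal_matching_def by blast
qed

text \<open>Converse criterion: an extra edge in a larger matching would avoid every member of
  \<open>M\<close>.\<close>

lemma maximal_matchingI:
  assumes "matching G M" and "\<And>e. e \<in> edges G \<Longrightarrow> e \<inter> \<Union>M \<noteq> {}"
  shows "maximal_matching G M"
  unfolding maximal_matching_def
proof (intro conjI notI)
  assume "\<exists>M'. matching G M' \<and> M \<subset> M'"
  then obtain M' e where M': "matching G M'" "M \<subseteq> M'" "e \<in> M'" "e \<notin> M" by blast
  then have "e \<inter> f = {}" if "f \<in> M" for f
    using that pairwiseD[of disjnt M' e f] by (auto simp: matching_def disjnt_def)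
  then have "e \<inter> \<Union>M = {}" by blast
  moreover have "e \<in> edges G" using M' by (auto simp: matching_def)
  ultimately show False using assms(2) by blast
qed fact

lemma matching_Un:
  assumes "matching G A" and "matching G B" and "\<And>a b. \<lbrakk>a \<in> A; b \<in> B\<rbrakk> \<Longrightarrow> a \<inter> b = {}"
  shows "matching G (A \<union> B)"
proof -
  have "disjnt a b" if "a \<in> A \<union> B" "b \<in> A \<union> B" "a \<noteq> b" for a b
    using that assms pairwiseD[of disjnt A a b] pairwiseD[of disjnt B a b]
    by (auto simp: matching_def disjnt_def)
  then show ?thesis
    using assms(1,2) by (simp add: matching_def pairwise_def)
qed

section \<open>The graph with the prescribed invariants\<close>

locale part_graph =
  fixes p q r :: nat
  assumes p_pos: "0 < p" and p_le_q: "p \<le> q" and q_le_r: "q \<le> r" and r_le: "r \<le> 2 * q"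
begin

text \<open>Truncation at \<open>p - 1\<close> makes each of the first \<open>p - 1\<close> pairs a
  part of its own and puts all remaining pairs into the last part.\<close>

definition part :: "nat \<Rightarrow> nat" where
  "part v = min (v div 2) (p - 1)"

definition core :: "nat \<Rightarrow> nat set" where
  "core c = {v. v < 2 * q \<and> part v = c}"

text \<open>The alternatives are clique edges, leaf edges and edges to the hub \<open>2 * r\<close>.
  The first argument is always a core vertex; \<open>H\<close> symmetrizes the relation.\<close>

definition link :: "nat \<Rightarrow> nat \<Rightarrow> bool" where
  "link u v \<longleftrightarrow> u < 2 * q \<and>
     (v < 2 * q \<and> u \<noteq> v \<and> part u = part v \<or> v < 2 * r \<and> v = 2 * q + u \<or> v = 2 * r)"

definition H :: "(nat, nat \<times> nat) pre_digraph" where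
  "H = \<lparr>verts = {..2 * r}, arcs = {(u, v). link u v \<or> link v u}, tail = fst, head = snd\<rparr>"

definition pair :: "nat \<Rightarrow> nat set" where
  "pair j = {2 * j, 2 * j + 1}"

lemma part_less: "part v < p"
  using p_pos by (simp add: part_def)

lemma link_neq: "link u v \<Longrightarrow> u \<noteq> v"
  using q_le_r by (auto simp: link_def)

lemma link_le: "link u v \<Longrightarrow> u \<le> 2 * r \<and> v \<le> 2 * r"
  using q_le_r by (auto simp: link_def)

lemma dominates_H: "u \<rightarrow>\<^bsub>H\<^esub> v \<longleftrightarrow> link u v \<or> link v u"
  by (auto simp: H_def arcs_ends_def arc_to_ends_def)

lemma edges_H: "edges H = {{u, v} |u v. link u v}"
  unfolding edges_def dominates_H by (auto simp: insert_commute)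

lemma finite_edges_H: "finite (edges H)"
  by (rule finite_subset[of _ "Pow {..2 * r}"]) (auto simp: edges_H dest: link_le)

section \<open>Simplicity and connectedness\<close>

lemma graph_H: "graph H"
proof unfold_locales
  have "{(u, v). link u v \<or> link v u} \<subseteq> {..2 * r} \<times> {..2 * r}"
    using link_le by auto
  then show "finite (arcs H)"
    unfolding H_def by (auto intro: finite_subset)
  show "symmetric H"
    unfolding symmetric_def by (rule symI) (auto simp: dominates_H)
qed (auto simp: H_def arc_to_ends_def dest: link_neq link_le)

lemma connected_H: "connected H"
proof -
  interpret graph H by (rule graph_H)
  \<comment> \<open>Every vertex has a path to the hub; by symmetry, such paths can be reversed and
    joined.\<close>
  have hub: "u \<rightarrow>\<^sup>*\<^bsub>H\<^esub> (2 * r)" if u: "u \<in> verts H" for u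
  proof -
    consider "u < 2 * q" | "2 * q \<le> u" "u < 2 * r" | "u = 2 * r"
      using u by (fastforce simp: H_def)
    then show ?thesis
    proof cases
      case 1
      then have "link u (2 * r)" by (simp add: link_def)
      then show ?thesis by (simp add: dominates_H)
    next
      case 2
      \<comment> \<open>A leaf reaches the hub through its core neighbour, whose index is below
        \<open>2 * q\<close> because \<open>r \<le> 2 * q\<close>.\<close>
      then have "link (u - 2 * q) u" "link (u - 2 * q) (2 * r)"
        using r_le by (auto simp: link_def)
      then have "u \<rightarrow>\<^bsub>H\<^esub> (u - 2 * q)" "(u - 2 * q) \<rightarrow>\<^bsub>H\<^esub> (2 * r)" by (simp_all add: dominates_H)
      then show ?thesis by (blast intro: reachable_trans)
    next
      case 3
      then show ?thesis using u by simp
    qed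
  qed
  then have "u \<rightarrow>\<^sup>*\<^bsub>H\<^esub> v" if "u \<in> verts H" "v \<in> verts H" for u v
    using that reachable_trans symmetric_reachable' by blast
  moreover have "verts H \<noteq> {}" by (simp add: H_def)
  ultimately show ?thesis
    unfolding connected_def strongly_connected_def by (simp add: reachable_mk_symmetricI)
qed

section \<open>Edges, parts and pairs\<close>

lemma edge_meets_unique_core:
  assumes "e \<in> edges H"
  shows "\<exists>!c. e \<inter> core c \<noteq> {}"
proof -
  obtain u v where "e = {u, v}" "link u v" using assms by (auto simp: edges_H)
  then show ?thesis
    \<comment> \<open>\<open>u\<close> is a core vertex, and \<open>v\<close> either shares its part
      or is at least \<open>2 * q\<close> and so lies in no core.\<close>
    using q_le_r by (intro ex1I[of _ "part u"]) (auto simp: link_def core_def)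
qed

lemma card_edge: "e \<in> edges H \<Longrightarrow> card e = 2"
  by (auto simp: edges_H dest!: link_neq)

lemma edge_in_core: "\<lbrakk>u \<in> core c; v \<in> core c; u \<noteq> v\<rbrakk> \<Longrightarrow> {u, v} \<in> edges H"
  by (auto simp: edges_H link_def core_def)

lemma pair_edge: "j < q \<Longrightarrow> pair j \<in> edges H"
  unfolding pair_def by (rule edge_in_core[of _ "part (2 * j)"]) (auto simp: core_def part_def)

lemma inj_pair: "inj pair"
  by (rule injI) (force simp: pair_def doubleton_eq_iff)

lemma pair_disjnt: "i \<noteq> j \<Longrightarrow> disjnt (pair i) (pair j)"
  by (auto simp: pair_def disjnt_def)

lemma matching_finite: "matching H M \<Longrightarrow> finite M"
  unfolding matching_def using finite_edges_H by (blast intro: finite_subset)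

lemma matching_pairs: "J \<subseteq> {..<q} \<Longrightarrow> matching H (pair ` J)"
  unfolding matching_def pairwise_image
  by (auto simp: pairwise_def intro: pair_edge pair_disjnt)

lemma card_pairs: "card (pair ` J) = card J"
  by (rule card_image) (rule inj_on_subset[OF inj_pair], simp)

lemma Union_pairs: "\<Union>(pair ` {..<q}) = {..<2 * q}"
proof
  show "{..<2 * q} \<subseteq> \<Union>(pair ` {..<q})"
  proof
    fix v assume "v \<in> {..<2 * q}"
    then have "v div 2 < q" "v \<in> pair (v div 2)" by (auto simp: pair_def)
    then show "v \<in> \<Union>(pair ` {..<q})" by blast
  qed
qed (auto simp: pair_def)

text \<open>A part is a disjoint union of pairs. Its even size is what makes the later count of
  matching edges sharp.\<close>

lemma card_core: "card (core c) = 2 * card {j. j < q \<and> min j (p - 1) = c}"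
proof -
  let ?J = "{j. j < q \<and> min j (p - 1) = c}"
  have "core c = \<Union>(pair ` ?J)"
  proof
    show "core c \<subseteq> \<Union>(pair ` ?J)"
    proof
      fix v assume "v \<in> core c"
      then have "v div 2 \<in> ?J" "v \<in> pair (v div 2)" by (auto simp: pair_def core_def part_def)
      then show "v \<in> \<Union>(pair ` ?J)" by blast
    qed
  qed (auto simp: core_def part_def pair_def)
  also have "card \<dots> = (\<Sum>j\<in>?J. card (pair j))"
    using pair_disjnt by (intro card_UN_disjoint) (auto simp: disjnt_def pair_def)
  also have "\<dots> = 2 * card ?J" by (simp add: pair_def)
  finally show ?thesis .
qed

section \<open>The induced matching number\<close>

lemma ind_match_num_H: "ind_match_num H = p"
proof (rule ind_match_num_eqI)
  fix M assume M: "induced_matching H M"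
  \<comment> \<open>\<open>f e\<close> is the index of the only part that \<open>e\<close> meets. It
    is injective on \<open>M\<close>: two edges meeting the same clique are joined by an edge of
    that clique.\<close>
  define f where "f e = (THE c. e \<inter> core c \<noteq> {})" for e
  have f: "e \<inter> core (f e) \<noteq> {}" if "e \<in> M" for e
    unfolding f_def
    by (rule theI', rule edge_meets_unique_core) (use M that in \<open>auto simp: induced_matching_def\<close>)
  have "inj_on f M"
  proof (rule inj_onI, rule ccontr)
    fix e e' assume e: "e \<in> M" "e' \<in> M" "f e = f e'" "e \<noteq> e'"
    then obtain u v where uv: "u \<in> e" "v \<in> e'" "u \<in> core (f e)" "v \<in> core (f e)"
      using f by (metis disjoint_iff)
    have "three_disjoint H e e'" using M e by (auto simp: induced_matching_def pairwise_def)
    moreover from this have "u \<noteq> v" using uv by (auto simp: three_disjoint_def)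
    then have "{u, v} \<in> edges H" using uv edge_in_core by blast
    ultimately show False using uv unfolding three_disjoint_def by blast
  qed
  moreover have "f e < p" if e: "e \<in> M" for e
  proof -
    obtain v where "v \<in> core (f e)" using f[OF e] by blast
    then show ?thesis using part_less[of v] by (simp add: core_def)
  qed
  then have "f ` M \<subseteq> {..<p}" by blast
  ultimately show "card M \<le> p" by (metis card_inj_on_le card_lessThan finite_lessThan)
next
  show "induced_matching H (pair ` {..<p})"
    unfolding induced_matching_def
  proof
    show "pair ` {..<p} \<subseteq> edges H" using pair_edge p_le_q by auto
    have "three_disjoint H (pair i) (pair j)" if ij: "i < p" "j < p" "i \<noteq> j" for i j
      unfolding three_disjoint_def
    proof (intro conjI notI)
      show "pair i \<inter> pair j = {}" using pair_disjnt ij by (auto simp: disjnt_def)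
      assume "\<exists>f. f \<in> edges H \<and> f \<inter> pair i \<noteq> {} \<and> f \<inter> pair j \<noteq> {}"
      then obtain f where f: "f \<in> edges H" "f \<inter> pair i \<noteq> {}" "f \<inter> pair j \<noteq> {}" by blast
      \<comment> \<open>The first \<open>p\<close> pairs lie in distinct parts, so an edge meeting
        two of them would meet two parts.\<close>
      have "pair k \<subseteq> core k" if "k < p" for k
        using that p_le_q by (auto simp: core_def part_def pair_def)
      then show False using f ij edge_meets_unique_core by blast
    qed
    then show "pairwise (three_disjoint H) (pair ` {..<p})" by (auto simp: pairwise_def)
  qed
qed (simp add: card_pairs)

section \<open>The minimum size of a maximal matching\<close>

lemma maximal_matching_at_core:
  assumes "maximal_matching H M"
  shows "card {j. j < q \<and> min j (p - 1) = c} \<le> card {e \<in> M. e \<inter> core c \<noteq> {}}"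
proof -
  let ?N = "{e \<in> M. e \<inter> core c \<noteq> {}}"
  have M: "matching H M" using assms by (simp add: maximal_matching_def)
  then have fin: "finite ?N" by (simp add: matching_finite)
  have "finite (core c)" by (simp add: core_def)
  \<comment> \<open>Two uncovered vertices of a part would span an uncovered edge of its
    clique.\<close>
  have "card (core c - \<Union>M) \<le> 1"
  proof (rule ccontr)
    assume "\<not> ?thesis"
    then obtain u v where "u \<noteq> v" "u \<in> core c - \<Union>M" "v \<in> core c - \<Union>M"
      by (metis One_nat_def card_le_Suc0_iff_eq card.infinite le0)
    then show False
      using maximal_matching_covers[OF assms edge_in_core[of u c v]] by blast
  qed
  moreover have "card (core c \<inter> \<Union>M) \<le> 2 * card ?N"
  proof -
    have sub: "core c \<inter> \<Union>M \<subseteq> \<Union>?N" by blast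
    have c2: "card e = 2" if "e \<in> ?N" for e
      using that M card_edge by (auto simp: matching_def)
    have "finite e" if "e \<in> ?N" for e using c2[OF that] by (simp add: card_ge_0_finite)
    then have "finite (\<Union>?N)" using fin by blast
    then have "card (core c \<inter> \<Union>M) \<le> card (\<Union>?N)" using sub by (rule card_mono)
    also have "\<dots> \<le> (\<Sum>e\<in>?N. card e)" by (rule card_Union_le_sum_card)
    also have "\<dots> = 2 * card ?N" using c2 by simp
    finally show ?thesis .
  qed
  moreover have "card (core c) = card (core c \<inter> \<Union>M) + card (core c - \<Union>M)"
    using \<open>finite (core c)\<close> by (metis card_Int_Diff)
  \<comment> \<open>Twice the number of pairs is at most \<open>2 * card ?N + 1\<close>; by parity
    the extra 1 disappears.\<close>
  ultimately show ?thesis by (simp add: card_core)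
qed

lemma min_match_num_H: "min_match_num H = q"
proof (rule min_match_num_eqI)
  fix M assume max: "maximal_matching H M"
  then have M: "matching H M" by (simp add: maximal_matching_def)
  let ?J = "\<lambda>c. {j. j < q \<and> min j (p - 1) = c}"
  let ?N = "\<lambda>c. {e \<in> M. e \<inter> core c \<noteq> {}}"
  \<comment> \<open>The local bound is summed over the parts: the \<open>?J c\<close> partition the
    pair indices, and no edge is counted in two of the \<open>?N c\<close>.\<close>
  have "{..<q} = (\<Union>c<p. ?J c)" using p_pos by auto
  then have "q = card (\<Union>c<p. ?J c)" by (metis card_lessThan)
  also have "\<dots> = (\<Sum>c<p. card (?J c))" by (rule card_UN_disjoint) auto
  also have "\<dots> \<le> (\<Sum>c<p. card (?N c))"
    by (intro sum_mono maximal_matching_at_core max)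
  also have "\<dots> = card (\<Union>c<p. ?N c)"
  proof (rule card_UN_disjoint[symmetric])
    have "?N c \<inter> ?N d = {}" if "c \<noteq> d" for c d
      using that M edge_meets_unique_core unfolding matching_def by blast
    then show "\<forall>c\<in>{..<p}. \<forall>d\<in>{..<p}. c \<noteq> d \<longrightarrow> ?N c \<inter> ?N d = {}" by blast
  qed (simp_all add: matching_finite[OF M])
  also have "\<dots> \<le> card M" by (rule card_mono) (auto simp: matching_finite[OF M])
  finally show "q \<le> card M" .
next
  show "maximal_matching H (pair ` {..<q})"
    \<comment> \<open>The pairs cover the whole core, and every edge has a core endpoint.\<close>
    by (rule maximal_matchingI)
      (auto simp only: matching_pairs order_refl Union_pairs, auto simp: edges_H link_def)
qed (simp_all add: finite_edges_H card_pairs)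

section \<open>The matching number\<close>

lemma match_num_H: "match_num H = r"
proof (rule match_num_eqI)
  fix M assume M: "matching H M"
  have "2 * card M = (\<Sum>e\<in>M. card e)"
    using M card_edge by (auto simp: matching_def subset_iff)
  also have "\<dots> = card (\<Union>M)"
    using M by (intro card_Union_disjoint[symmetric])
      (auto simp: matching_def edges_H)
  also have "\<dots> \<le> card {..2 * r}"
    by (rule card_mono) (use M link_le in \<open>fastforce simp: matching_def edges_H\<close>)+
  finally show "card M \<le> r" by simp
next
  \<comment> \<open>The leaf edges use exactly the core vertices of the first \<open>r - q\<close>
    pairs; \<open>?P\<close> takes the other pairs. The total is
    \<open>2 * (r - q) + (q - (r - q)) = r\<close>.\<close>
  let ?L = "(\<lambda>u. {u, 2 * q + u}) ` {..<2 * (r - q)}"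
  let ?P = "pair ` {r - q..<q}"
  have "link u (2 * q + u)" if "u < 2 * (r - q)" for u
    using that r_le by (auto simp: link_def)
  then have "?L \<subseteq> edges H" unfolding edges_H by blast
  \<comment> \<open>Since \<open>2 * (r - q) \<le> 2 * q\<close>, no leaf index coincides with a
    core endpoint.\<close>
  moreover have "pairwise disjnt ?L"
    using r_le by (auto simp: pairwise_def disjnt_def)
  ultimately have "matching H ?L" by (simp add: matching_def)
  moreover have "matching H ?P" by (rule matching_pairs) auto
  moreover have LP: "l \<inter> P = {}" if "l \<in> ?L" "P \<in> ?P" for l P
    using that by (auto simp: pair_def)
  ultimately show "matching H (?L \<union> ?P)" by (rule matching_Un)
  \<comment> \<open>An edge common to both families would be disjoint from itself, hence
    empty.\<close>
  have "?L \<inter> ?P = {}"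
  proof (intro equals0I, elim IntE)
    fix e assume "e \<in> ?L" "e \<in> ?P"
    then have "e \<inter> e = {}" by (rule LP)
    with \<open>e \<in> ?L\<close> show False by auto
  qed
  moreover have "card ?L = 2 * (r - q)"
    by (subst card_image) (auto simp: inj_on_def doubleton_eq_iff)
  ultimately show "card (?L \<union> ?P) = r"
    using q_le_r r_le by (simp add: card_Un_disjoint card_pairs)
qed

end

theorem theorem1p3:
  fixes p q r :: nat
  assumes "0 < p" and "p \<le> q" and "q \<le> r" and "r \<le> 2 * q"
  shows "\<exists>G :: (nat, nat \<times> nat) pre_digraph.
           graph G \<and> connected G \<and>
           ind_match_num G = p \<and> min_match_num G = q \<and> match_num G = r"
proof -
  interpret part_graph p q r using assms by unfold_locales
  show ?thesis
    using graph_H connected_H ind_match_num_H min_match_num_H match_num_H by blast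
qed

end
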